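(* Let $P$ be a non-constant polynomial over $\mathbb{C}_p$ and let $f$ be a transcendental entire function on $\mathbb{C}_p$ such that $P\circ f=f\circ P$. Then the polynomial $P$ is of one of the following forms: (i) $P(x)=x$; (ii) $P(x)=ax+b$, where $a,b\in\mathbb{C}_p$ are such that $a$ is an $n$-th root of unity for some non-zero integer $n$.
   Context: $p$ is a prime number and $\mathbb{C}_p$ is the completion of an algebraic closure of the field $\mathbb{Q}_p$ of $p$-adic numbers, with the usual $p$-adic absolute value. An entire function on $\mathbb{C}_p$ is a power series over $\mathbb{C}_p$ converging on all of $\mathbb{C}_p$; it is transcendental if it is not a polynomial. *)

theory Defs
  imports
    "HOL-Algebra.Algebraic_Closure_Type"
    "HOL-Analysis.Analysis"
    "HOL-Computational_Algebra.Computational_Algebra"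
begin

section \<open>Absolute values and completions of fields\<close>

definition absolute_value :: "('a::field \<Rightarrow> real) \<Rightarrow> bool" where
  "absolute_value v \<longleftrightarrow>
     (\<forall>x. 0 \<le> v x) \<and> (\<forall>x. v x = 0 \<longleftrightarrow> x = 0) \<and>
     (\<forall>x y. v (x * y) = v x * v y) \<and> (\<forall>x y. v (x + y) \<le> v x + v y)"

text \<open>
  A field with an absolute value \<open>vabs\<close>, carrying the metric and the topology this induces.
  The remaining axioms of an absolute value follow from those of a metric space, see
  \<open>absolute_value_vabs\<close>. The class \<open>real_normed_field\<close> is not applicable, since the
  \<open>p\<close>-adic fields are not real algebras.
\<close>

class valued_field = field + metric_space +
  fixes vabs :: "'a \<Rightarrow> real"
  assumes dist_vabs: "dist x y = vabs (x - y)"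
    and vabs_mult: "vabs (x * y) = vabs x * vabs y"

lemma absolute_value_vabs: "absolute_value (vabs :: 'a::valued_field \<Rightarrow> real)"
proof -
  have vabs_dist: "vabs x = dist x 0" for x :: 'a
    by (simp add: dist_vabs)
  have triangle: "vabs (x + y) \<le> vabs x + vabs y" for x y :: 'a
    using dist_triangle[of x "- y" 0] dist_commute[of "- y" 0] by (simp add: dist_vabs)
  show ?thesis
    unfolding absolute_value_def
    by (auto simp: vabs_mult triangle) (simp_all add: vabs_dist)
qed

class complete_valued_field = valued_field + complete_space

definition field_embedding :: "('a::field \<Rightarrow> 'b::field) \<Rightarrow> bool" where
  "field_embedding \<iota> \<longleftrightarrow>
     \<iota> 1 = 1 \<and> (\<forall>x y. \<iota> (x + y) = \<iota> x + \<iota> y) \<and> (\<forall>x y. \<iota> (x * y) = \<iota> x * \<iota> y)"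

text \<open>
  The map \<open>\<iota>\<close> exhibits the complete valued field \<open>'b\<close> as the completion of the field \<open>'a\<close>
  with respect to the absolute value \<open>v\<close>.
\<close>

definition is_completion :: "('a::field \<Rightarrow> real) \<Rightarrow> ('a \<Rightarrow> 'b::complete_valued_field) \<Rightarrow> bool" where
  "is_completion v \<iota> \<longleftrightarrow>
     absolute_value v \<and> field_embedding \<iota> \<and> (\<forall>x. vabs (\<iota> x) = v x) \<and> closure (range \<iota>) = UNIV"


section \<open>The field of complex \<open>p\<close>-adic numbers\<close>

text \<open>
  For a fraction \<open>a / b\<close> in lowest terms, the value is \<open>p\<close> to the power
  \<open>v\<^sub>p(b) - v\<^sub>p(a)\<close>; thus \<open>p\<close> itself has absolute value \<open>1 / p\<close>.
\<close>

definition padic_abs :: "nat \<Rightarrow> rat \<Rightarrow> real" where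
  "padic_abs p r =
     (if r = 0 then 0
      else let (a, b) = quotient_of r
           in real p powi (int (multiplicity (int p) b) - int (multiplicity (int p) a)))"

text \<open>
  The complete valued field \<open>'c\<close> is the completion of an algebraic closure of \<open>\<rat>\<^sub>p\<close>:
  \<open>'q\<close> is \<open>\<rat>\<^sub>p\<close>, the completion of \<open>\<rat>\<close> for the \<open>p\<close>-adic absolute value (via \<open>\<iota>\<close>);
  \<open>w\<close> is the extension of the absolute value of \<open>\<rat>\<^sub>p\<close> to the algebraic closure;
  and \<open>'c\<close> is the completion with respect to \<open>w\<close> (via \<open>j\<close>). As \<open>\<rat>\<^sub>p\<close> is only determined up to
  isomorphism, results about \<open>\<complex>\<^sub>p\<close> are stated for arbitrary such data.
\<close>

definition is_Cp ::
  "nat \<Rightarrow> (rat \<Rightarrow> 'q::complete_valued_field) \<Rightarrow> ('q alg_closure \<Rightarrow> real) \<Rightarrow>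
   ('q alg_closure \<Rightarrow> 'c::complete_valued_field) \<Rightarrow> bool" where
  "is_Cp p \<iota> w j \<longleftrightarrow>
     is_completion (padic_abs p) \<iota> \<and>
     absolute_value w \<and> (\<forall>x. w (to_ac x) = vabs x) \<and>
     is_completion w j"


section \<open>Entire functions\<close>

definition entire_series :: "'c::complete_valued_field fps \<Rightarrow> bool" where
  "entire_series F \<longleftrightarrow> (\<forall>x. summable (\<lambda>n. fps_nth F n * x ^ n))"

text \<open>The library's \<open>eval_fps\<close> requires a real normed algebra.\<close>

definition entire_fun :: "'c::complete_valued_field fps \<Rightarrow> 'c \<Rightarrow> 'c" where
  "entire_fun F x = (\<Sum>n. fps_nth F n * x ^ n)"

definition transcendental_entire :: "'c::complete_valued_field fps \<Rightarrow> bool" where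
  "transcendental_entire F \<longleftrightarrow> entire_series F \<and> (\<nexists>Q. F = fps_of_poly Q)"

end

theory Submission
  imports Defs
begin

text \<open>
  Apart from completeness, the proof uses two properties of \<open>\<complex>\<^sub>p\<close>: its absolute value is ultrametric
  and the set of its values is dense in the positive reals. The ultrametric inequality makes \<open>|f(x)|\<close> explicit: if one term of
  the power series is strictly larger than the others at \<open>x\<close>, then \<open>|f(x)|\<close> equals the absolute
  value of this term. Two consequences carry the proof.

  First, a nonzero power series has finitely many zeros in a disc on which its terms tend to zero
  (\<open>finite_zeros\<close>, a form of Strassmann's theorem), so a transcendental entire function agrees with a
  polynomial at finitely many points of a disc only. If \<open>f\<close> commutes with \<open>x \<mapsto> a x + b\<close> where
  \<open>a \<noteq> 1\<close>, let \<open>c\<close> be the fixed point of this map. Then \<open>f(c + a\<^sup>k) = c + a\<^sup>k (f(c + 1) - c)\<close> for all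
  integers \<open>k\<close>, so \<open>f\<close> agrees with an affine map at the points \<open>c + a\<^sup>k\<close>; those with \<open>k \<ge> 0\<close>, or
  those with \<open>k \<le> 0\<close>, lie in a disc, and so \<open>a\<close> is a root of unity
  (\<open>root_of_unity_if_commutes_with_affine\<close>).

  Second, for all but finitely many radii \<open>s\<close> in an interval \<open>[1, R]\<close> the inequality
  \<open>|f(x)| \<ge> |a\<^sub>n| s\<^sup>n\<close> holds for all \<open>n\<close> and all \<open>x\<close> with \<open>|x| = s\<close> (\<open>finite_exceptional_radii\<close>).
  If the degree of \<open>P\<close> is at least \<open>2\<close>, the equation \<open>f(P\<^sup>k(x)) = P\<^sup>k(f(x))\<close> bounds \<open>f\<close> along the
  orbits of \<open>P\<close> by a fixed power of the absolute value of the point. For a transcendental function this is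
  possible on exceptional spheres only, far out; but since the values are dense, the orbits meet too
  many spheres (\<open>degree_le_1_if_commutes\<close>).
\<close>

section \<open>Valued fields\<close>

lemma vabs_nonneg [simp]: "0 \<le> vabs (x::'a::valued_field)"
  and vabs_eq_0 [simp]: "vabs x = 0 \<longleftrightarrow> x = 0"
  and vabs_triangle: "vabs (x + y) \<le> vabs x + vabs y"
  using absolute_value_vabs[where 'a = 'a] by (auto simp: absolute_value_def)

lemma vabs_0 [simp]: "vabs (0::'a::valued_field) = 0"
  by simp

lemma vabs_pos_iff [simp]: "0 < vabs x \<longleftrightarrow> x \<noteq> (0::'a::valued_field)"
  using vabs_nonneg[of x] by (simp only: less_le) auto

lemma not_vabs_less_0 [simp]: "\<not> vabs (x::'a::valued_field) < 0"
  by (simp add: not_less)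

lemma vabs_1 [simp]: "vabs (1::'a::valued_field) = 1"
  using vabs_mult[of "1::'a" 1] by (simp del: vabs_eq_0 add: vabs_eq_0[of "1::'a"])

lemma vabs_power: "vabs ((x::'a::valued_field) ^ n) = vabs x ^ n"
  by (induction n) (auto simp: vabs_mult)

lemma vabs_inverse: "vabs (inverse (x::'a::valued_field)) = inverse (vabs x)"
proof (cases "x = 0")
  case False
  then have "vabs x * vabs (inverse x) = 1"
    by (simp flip: vabs_mult)
  then show ?thesis
    using inverse_unique by metis
qed auto

lemma vabs_diff_commute: "vabs ((x::'a::valued_field) - y) = vabs (y - x)"
  using dist_commute[of x y] by (simp add: dist_vabs)

lemma vabs_minus [simp]: "vabs (- (x::'a::valued_field)) = vabs x"
  using vabs_diff_commute[of 0 x] by simp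

lemma vabs_sum: "vabs (\<Sum>i\<in>I. f i :: 'a::valued_field) \<le> (\<Sum>i\<in>I. vabs (f i))"
proof (induction I rule: infinite_finite_induct)
  case (insert i I)
  then show ?case
    using vabs_triangle[of "f i" "sum f I"] by simp
qed auto

lemma tendsto_vabs_iff:
  "(f \<longlongrightarrow> (l::'a::valued_field)) G \<longleftrightarrow> ((\<lambda>n. vabs (f n - l)) \<longlongrightarrow> 0) G"
  by (subst tendsto_dist_iff) (simp add: dist_vabs)

text \<open>
  Addition is continuous for the metric of an absolute value, which makes the general theory of
  limits and of convergent series available.
\<close>

instance valued_field \<subseteq> topological_ab_group_add
proof
  fix a b :: 'a
  have "((\<lambda>x. vabs (fst x - a) + vabs (snd x - b)) \<longlongrightarrow> 0 + 0) (nhds a \<times>\<^sub>F nhds b)"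
    by (intro tendsto_add) (use tendsto_vabs_iff filterlim_fst filterlim_snd in blast)+
  then have lim: "((\<lambda>x. vabs (fst x - a) + vabs (snd x - b)) \<longlongrightarrow> 0) (nhds a \<times>\<^sub>F nhds b)"
    by simp
  have "((\<lambda>x. vabs (fst x + snd x - (a + b))) \<longlongrightarrow> 0) (nhds a \<times>\<^sub>F nhds b)"
  proof (rule Lim_null_comparison[OF _ lim])
    show "\<forall>\<^sub>F x in nhds a \<times>\<^sub>F nhds b.
        norm (vabs (fst x + snd x - (a + b))) \<le> vabs (fst x - a) + vabs (snd x - b)"
      using vabs_triangle[of "fst x - a" "snd x - b" for x :: "'a \<times> 'a"]
      by (intro always_eventually) (simp add: algebra_simps)
  qed
  then show "((\<lambda>x. fst x + snd x) \<longlongrightarrow> a + b) (nhds a \<times>\<^sub>F nhds b)"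
    by (subst tendsto_vabs_iff)
  have "((\<lambda>x. x) \<longlongrightarrow> a) (nhds a)"
    by (simp add: filterlim_ident)
  then show "(uminus \<longlongrightarrow> - a) (nhds a)"
    by (subst (asm) tendsto_vabs_iff, subst tendsto_vabs_iff) (simp add: vabs_diff_commute)
qed

lemma tendsto_mult_left_valued:
  fixes c :: "'a::valued_field"
  assumes "(f \<longlongrightarrow> l) G"
  shows "((\<lambda>n. c * f n) \<longlongrightarrow> c * l) G"
proof -
  have "((\<lambda>n. vabs c * vabs (f n - l)) \<longlongrightarrow> vabs c * 0) G"
    using assms by (intro tendsto_mult tendsto_const) (subst (asm) tendsto_vabs_iff)
  then show ?thesis
    by (subst tendsto_vabs_iff) (simp add: vabs_mult[symmetric] algebra_simps)
qed

lemma sums_mult_left_valued: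
  fixes c :: "'a::valued_field"
  shows "t sums s \<Longrightarrow> (\<lambda>n. c * t n) sums (c * s)"
  unfolding sums_def by (simp add: tendsto_mult_left_valued flip: sum_distrib_left)

lemma summable_vabs_tendsto_0:
  fixes t :: "nat \<Rightarrow> 'a::valued_field"
  assumes "summable t"
  shows "(\<lambda>n. vabs (t n)) \<longlonglongrightarrow> 0"
proof -
  obtain s where "(\<lambda>n. sum t {..<n}) \<longlonglongrightarrow> s"
    using assms by (auto simp: summable_def sums_def)
  then have "(\<lambda>n. sum t {..<Suc n} - sum t {..<n}) \<longlonglongrightarrow> s - s"
    by (intro tendsto_diff) (auto dest: LIMSEQ_Suc)
  then show ?thesis
    by (subst (asm) tendsto_vabs_iff) simp
qed

section \<open>Series over non-archimedean fields\<close>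

locale nonarchimedean =
  fixes dummy :: "'c::complete_valued_field itself"
  assumes ultrametric: "vabs (x + y :: 'c) \<le> max (vabs x) (vabs y)"
begin

lemma vabs_add_less: "vabs x < e \<Longrightarrow> vabs y < e \<Longrightarrow> vabs (x + y :: 'c) < e"
  using ultrametric[of x y] by simp

lemma vabs_diff_less: "vabs x < e \<Longrightarrow> vabs y < e \<Longrightarrow> vabs (x - y :: 'c) < e"
  using vabs_add_less[of x e "- y"] by simp

lemma vabs_add_dominant: "vabs y < vabs x \<Longrightarrow> vabs (x + y :: 'c) = vabs x"
  using ultrametric[of x y] ultrametric[of "x + y" "- y"] by simp

lemma vabs_sum_less:
  assumes "0 < e" and "\<And>i. i \<in> I \<Longrightarrow> vabs (t i :: 'c) < e"
  shows "vabs (sum t I) < e"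
  using assms(2)
proof (induction I rule: infinite_finite_induct)
  case (insert i I)
  then show ?case by (simp add: vabs_add_less)
qed (use assms(1) in auto)

text \<open>The strict bound survives the limit because open balls are closed in an ultrametric space.\<close>

lemma vabs_sums_less:
  assumes "t sums (s::'c)" and "0 < e" and "\<And>n. vabs (t n) < e"
  shows "vabs s < e"
proof -
  have "\<forall>\<^sub>F n in sequentially. dist (sum t {..<n}) s < e"
    using assms(1,2) by (auto simp: sums_def dest: tendstoD)
  then obtain n where "vabs (sum t {..<n} - s) < e"
    by (auto simp: dist_vabs eventually_sequentially)
  then show ?thesis
    using vabs_diff_less[OF vabs_sum_less[of e "{..<n}" t], of "sum t {..<n} - s"] assms(2,3) by simp
qed

text \<open>
  When one term is strictly larger than each of the others, nothing can cancel it. This is the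
  source of all lower bounds below.
\<close>

lemma vabs_sums_dominant:
  assumes "t sums (s::'c)" and "\<And>m. m \<noteq> n \<Longrightarrow> vabs (t m) < vabs (t n)"
  shows "vabs s = vabs (t n)"
proof -
  have pos: "0 < vabs (t n)"
    by (rule le_less_trans[OF vabs_nonneg assms(2)[of "Suc n"]]) simp
  have "(\<lambda>m. - (if m = n then t m else 0)) sums (- t n)"
    using sums_single[of n t] unfolding sums_def by (simp only: sum_negf) (rule tendsto_minus)
  then have "(\<lambda>m. t m + - (if m = n then t m else 0)) sums (s + - t n)"
    by (rule sums_add[OF assms(1)])
  also have "(\<lambda>m. t m + - (if m = n then t m else 0)) = (\<lambda>m. if m = n then 0 else t m)"
    by auto
  finally have "(\<lambda>m. if m = n then 0 else t m) sums (s + - t n)" .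
  then have "vabs (s + - t n) < vabs (t n)"
    by (rule vabs_sums_less) (use assms(2) pos in auto)
  then show ?thesis
    using vabs_add_dominant[of "s + - t n" "t n"] by (simp add: add.commute)
qed

text \<open>
  By the ultrametric inequality a block of terms is no larger than its largest member, so the
  partial sums form a Cauchy sequence.
\<close>

lemma summable_if_tendsto_0:
  assumes "(\<lambda>n. vabs (t n :: 'c)) \<longlonglongrightarrow> 0"
  shows "summable t"
proof -
  have "Cauchy (\<lambda>n. sum t {..<n})"
  proof (rule metric_CauchyI)
    fix e :: real
    assume e: "0 < e"
    then have "\<forall>\<^sub>F n in sequentially. vabs (t n) < e"
      using order_tendstoD(2)[OF assms] by blast
    then obtain M where M: "\<And>n. n \<ge> M \<Longrightarrow> vabs (t n) < e"
      by (auto simp: eventually_sequentially)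
    have "dist (sum t {..<m}) (sum t {..<M}) < e" if "m \<ge> M" for m
    proof -
      have "sum t {..<m} - sum t {..<M} = sum t {M..<m}"
        using sum_diff_nat_ivl[of 0 M m t] that by (simp add: lessThan_atLeast0)
      then show ?thesis
        using vabs_sum_less[OF e, of "{M..<m}" t] M by (simp add: dist_vabs)
    qed
    then have "dist (sum t {..<m}) (sum t {..<n}) < e" if "m \<ge> M" "n \<ge> M" for m n
      using that vabs_diff_less[of "sum t {..<m} - sum t {..<M}" e "sum t {..<n} - sum t {..<M}"]
      by (simp add: dist_vabs)
    then show "\<exists>M. \<forall>m\<ge>M. \<forall>n\<ge>M. dist (sum t {..<m}) (sum t {..<n}) < e"
      by blast
  qed
  then show ?thesis
    by (simp add: summable_iff_convergent Cauchy_convergent_iff)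
qed

section \<open>Zeros of power series\<close>

lemma summable_power_series:
  assumes "(\<lambda>n. vabs (a n :: 'c) * R ^ n) \<longlonglongrightarrow> 0" and "vabs x \<le> R"
  shows "summable (\<lambda>n. a n * x ^ n)"
proof (rule summable_if_tendsto_0)
  show "(\<lambda>n. vabs (a n * x ^ n)) \<longlonglongrightarrow> 0"
    by (rule Lim_null_comparison[OF _ assms(1)])
       (use assms(2) in \<open>auto simp: vabs_mult vabs_power intro!: always_eventually mult_left_mono power_mono\<close>)
qed

text \<open>
  Division of a power series by \<open>X - \<alpha>\<close> at a zero \<open>\<alpha>\<close>: the coefficients of the quotient are the
  sums \<open>b\<^sub>j = a\<^sub>j\<^sub>+\<^sub>1 + a\<^sub>j\<^sub>+\<^sub>2 \<alpha> + a\<^sub>j\<^sub>+\<^sub>3 \<alpha>\<^sup>2 + \<dots>\<close>. The ultrametric inequality makes each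
  of them as small as its largest term.
\<close>

definition divide_root :: "(nat \<Rightarrow> 'c) \<Rightarrow> 'c \<Rightarrow> nat \<Rightarrow> 'c" where
  "divide_root a \<alpha> j = (\<Sum>i. a (Suc j + i) * \<alpha> ^ i)"

lemma divide_root_sums:
  assumes lim: "(\<lambda>n. vabs (a n) * R ^ n) \<longlonglongrightarrow> 0" and "vabs \<alpha> \<le> R" and "0 < R"
  shows "(\<lambda>i. a (Suc j + i) * \<alpha> ^ i) sums divide_root a \<alpha> j"
proof -
  have "(\<lambda>i. inverse (R ^ Suc j) * (vabs (a (i + Suc j)) * R ^ (i + Suc j))) \<longlonglongrightarrow> inverse (R ^ Suc j) * 0"
    by (intro tendsto_mult tendsto_const LIMSEQ_ignore_initial_segment[OF lim])
  then have "(\<lambda>i. vabs (a (Suc j + i)) * R ^ i) \<longlonglongrightarrow> 0"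
    using \<open>0 < R\<close> by (simp add: power_add field_simps)
  then show ?thesis
    unfolding divide_root_def
    by (intro summable_sums summable_power_series[of _ R] assms)
qed

lemma vabs_divide_root_less:
  assumes lim: "(\<lambda>n. vabs (a n) * R ^ n) \<longlonglongrightarrow> 0" and \<alpha>: "vabs \<alpha> \<le> R" and "0 < R"
    and less: "\<And>n. n > j \<Longrightarrow> vabs (a n) * R ^ n < e"
  shows "vabs (divide_root a \<alpha> j) * R ^ Suc j < e"
proof -
  have e: "0 < e"
    using less[of "Suc j"] \<open>0 < R\<close> by (meson le_less_trans lessI mult_nonneg_nonneg vabs_nonneg zero_le_power less_imp_le)
  have "vabs (divide_root a \<alpha> j) < e / R ^ Suc j"
  proof (rule vabs_sums_less[OF divide_root_sums[OF assms(1-3)]])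
    fix i
    have "vabs (a (Suc j + i) * \<alpha> ^ i) \<le> vabs (a (Suc j + i)) * R ^ i"
      using \<alpha> by (auto simp: vabs_mult vabs_power intro!: mult_left_mono power_mono)
    also have "\<dots> < e / R ^ Suc j"
      using less[of "Suc j + i"] \<open>0 < R\<close> by (simp add: power_add field_simps)
    finally show "vabs (a (Suc j + i) * \<alpha> ^ i) < e / R ^ Suc j" .
  qed (use e \<open>0 < R\<close> in auto)
  then show ?thesis
    using \<open>0 < R\<close> by (simp add: field_simps)
qed

lemma divide_root_tendsto_0:
  assumes lim: "(\<lambda>n. vabs (a n) * R ^ n) \<longlonglongrightarrow> 0" and \<alpha>: "vabs \<alpha> \<le> R" and "0 < R"
  shows "(\<lambda>n. vabs (divide_root a \<alpha> n) * R ^ n) \<longlonglongrightarrow> 0"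
proof -
  have "(\<lambda>n. vabs (divide_root a \<alpha> n) * R ^ Suc n) \<longlonglongrightarrow> 0"
  proof (rule LIMSEQ_I)
    fix e :: real
    assume "0 < e"
    then have "\<forall>\<^sub>F n in sequentially. vabs (a n) * R ^ n < e"
      using order_tendstoD(2)[OF lim] by blast
    then obtain M where M: "\<And>n. n \<ge> M \<Longrightarrow> vabs (a n) * R ^ n < e"
      by (auto simp: eventually_sequentially)
    have "norm (vabs (divide_root a \<alpha> n) * R ^ Suc n - 0) < e" if "n \<ge> M" for n
      using vabs_divide_root_less[OF assms, of n e] M that \<open>0 < R\<close>
      by (simp add: abs_mult)
    then show "\<exists>M. \<forall>n\<ge>M. norm (vabs (divide_root a \<alpha> n) * R ^ Suc n - 0) < e"
      by blast
  qed
  then have "(\<lambda>n. inverse R * (vabs (divide_root a \<alpha> n) * R ^ Suc n)) \<longlonglongrightarrow> inverse R * 0"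
    by (intro tendsto_mult tendsto_const)
  then show ?thesis
    using \<open>0 < R\<close> by (simp add: field_simps)
qed

text \<open>
  The factorisation holds coefficient by coefficient, so that no double series has to be
  rearranged: the partial sums of both sides differ by a single term, which tends to zero.
\<close>

lemma divide_root_eval:
  assumes lim: "(\<lambda>n. vabs (a n) * R ^ n) \<longlonglongrightarrow> 0" and \<alpha>: "vabs \<alpha> \<le> R" and "0 < R"
    and root: "(\<Sum>n. a n * \<alpha> ^ n) = 0" and x: "vabs x \<le> R"
  shows "(\<Sum>n. a n * x ^ n) = (x - \<alpha>) * (\<Sum>n. divide_root a \<alpha> n * x ^ n)"
proof -
  let ?b = "divide_root a \<alpha>"
  have sb: "summable (\<lambda>n. ?b n * x ^ n)"
    by (rule summable_power_series[OF divide_root_tendsto_0[OF assms(1-3)] x])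
  \<comment> \<open>The coefficients of \<open>(X - \<alpha>) \<Sum> b\<^sub>j X\<^sup>j\<close> are those of the given series.\<close>
  have b_rec: "a (Suc j) = ?b j - \<alpha> * ?b (Suc j)" for j
  proof -
    have "(\<lambda>i. a (Suc j + Suc i) * \<alpha> ^ Suc i) sums (\<alpha> * ?b (Suc j))"
      using sums_mult_left_valued[OF divide_root_sums[OF assms(1-3), of "Suc j"], of \<alpha>]
      by (simp add: mult_ac)
    then have "(\<lambda>i. a (Suc j + i) * \<alpha> ^ i) sums (\<alpha> * ?b (Suc j) + a (Suc j))"
      by (drule_tac sums_Suc) simp
    then show ?thesis
      using divide_root_sums[OF assms(1-3), of j] sums_unique2 by fastforce
  qed
  have b_0: "a 0 = - \<alpha> * ?b 0"
  proof -
    have "(\<lambda>i. a (Suc i) * \<alpha> ^ Suc i) sums (\<alpha> * ?b 0)"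
      using sums_mult_left_valued[OF divide_root_sums[OF assms(1-3), of 0], of \<alpha>]
      by (simp add: mult_ac)
    then have "(\<lambda>i. a i * \<alpha> ^ i) sums (\<alpha> * ?b 0 + a 0)"
      by (drule_tac sums_Suc) simp
    then have "\<alpha> * ?b 0 + a 0 = 0"
      using root sums_unique by metis
    then show ?thesis
      by (simp add: add_eq_0_iff)
  qed
  have partial: "(\<Sum>j<Suc n. a j * x ^ j) = (x - \<alpha>) * (\<Sum>j<n. ?b j * x ^ j) - \<alpha> * (?b n * x ^ n)" for n
    by (induction n) (simp_all add: b_0 b_rec algebra_simps)
  have "(\<lambda>n. (x - \<alpha>) * (\<Sum>j<n. ?b j * x ^ j) - \<alpha> * (?b n * x ^ n))
      \<longlonglongrightarrow> (x - \<alpha>) * (\<Sum>n. ?b n * x ^ n) - \<alpha> * 0"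
  proof (intro tendsto_diff tendsto_mult_left_valued)
    show "(\<lambda>n. \<Sum>j<n. ?b j * x ^ j) \<longlonglongrightarrow> (\<Sum>n. ?b n * x ^ n)"
      using sb by (rule summable_LIMSEQ)
    show "(\<lambda>n. ?b n * x ^ n) \<longlonglongrightarrow> 0"
      using summable_vabs_tendsto_0[OF sb] by (subst tendsto_vabs_iff) simp
  qed
  then have "(\<lambda>n. \<Sum>j<Suc n. a j * x ^ j) \<longlonglongrightarrow> (x - \<alpha>) * (\<Sum>n. ?b n * x ^ n)"
    by (simp only: partial) simp
  then have "(\<lambda>n. \<Sum>j<n. a j * x ^ j) \<longlonglongrightarrow> (x - \<alpha>) * (\<Sum>n. ?b n * x ^ n)"
    by (rule LIMSEQ_imp_Suc)
  then show ?thesis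
    by (simp add: sums_def[symmetric] sums_iff)
qed

text \<open>
  This is the finiteness part of Strassmann's theorem. Dividing by \<open>X - \<alpha>\<close> at a zero \<open>\<alpha>\<close> lowers the dominating index
  \<open>N\<close> by one, and for \<open>N = 0\<close> the constant term exceeds all the others, so that there is no zero.
\<close>

lemma finite_zeros_if_dominating_index:
  assumes "(\<lambda>n. vabs (a n :: 'c) * R ^ n) \<longlonglongrightarrow> 0" and "0 < R"
    and "\<And>n. n > N \<Longrightarrow> vabs (a n) * R ^ n < vabs (a N) * R ^ N"
  shows "finite {x. vabs x \<le> R \<and> (\<Sum>n. a n * x ^ n) = 0}"
  using assms(1,3)
proof (induction N arbitrary: a)
  case 0
  have pos: "vabs (a 0) > 0"
    using le_less_trans[OF mult_nonneg_nonneg[OF vabs_nonneg zero_le_power] "0.prems"(2)[of 1]] \<open>0 < R\<close>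
    by simp
  have False if x: "vabs x \<le> R" and z: "(\<Sum>n. a n * x ^ n) = 0" for x
  proof -
    have "(\<lambda>n. a n * x ^ n) sums 0"
      using summable_power_series[OF "0.prems"(1) x] z by (simp add: sums_iff)
    then have "vabs (0::'c) = vabs (a 0 * x ^ 0)"
    proof (rule vabs_sums_dominant[where n = 0])
      fix n :: nat
      assume "n \<noteq> 0"
      have "vabs (a n * x ^ n) \<le> vabs (a n) * R ^ n"
        using x by (auto simp: vabs_mult vabs_power intro!: mult_left_mono power_mono)
      also have "\<dots> < vabs (a 0 * x ^ 0)"
        using "0.prems"(2)[of n] \<open>n \<noteq> 0\<close> by simp
      finally show "vabs (a n * x ^ n) < vabs (a 0 * x ^ 0)" .
    qed
    then show False
      using pos by simp
  qed
  then have "{x. vabs x \<le> R \<and> (\<Sum>n. a n * x ^ n) = 0} \<subseteq> {}"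
    by blast
  then show ?case
    by (rule finite_subset) simp
next
  case (Suc N)
  show ?case
  proof (cases "\<exists>\<alpha>. vabs \<alpha> \<le> R \<and> (\<Sum>n. a n * \<alpha> ^ n) = 0")
    case True
    then obtain \<alpha> where \<alpha>: "vabs \<alpha> \<le> R" "(\<Sum>n. a n * \<alpha> ^ n) = 0"
      by blast
    note sums = divide_root_sums[OF Suc.prems(1) \<alpha>(1) \<open>0 < R\<close>]
    have "vabs (divide_root a \<alpha> N) = vabs (a (Suc N + 0) * \<alpha> ^ 0)"
    proof (rule vabs_sums_dominant[OF sums])
      fix i :: nat
      assume "i \<noteq> 0"
      have "vabs (a (Suc N + i) * \<alpha> ^ i) \<le> vabs (a (Suc N + i)) * R ^ i"
        using \<alpha> by (auto simp: vabs_mult vabs_power intro!: mult_left_mono power_mono)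
      also have "\<dots> < vabs (a (Suc N + 0) * \<alpha> ^ 0)"
        using Suc.prems(2)[of "Suc N + i"] \<open>i \<noteq> 0\<close> \<open>0 < R\<close> by (simp add: power_add)
      finally show "vabs (a (Suc N + i) * \<alpha> ^ i) < vabs (a (Suc N + 0) * \<alpha> ^ 0)" .
    qed
    then have top: "vabs (divide_root a \<alpha> N) = vabs (a (Suc N))"
      by simp
    have "finite {x. vabs x \<le> R \<and> (\<Sum>n. divide_root a \<alpha> n * x ^ n) = 0}"
    proof (rule Suc.IH)
      show "(\<lambda>n. vabs (divide_root a \<alpha> n) * R ^ n) \<longlonglongrightarrow> 0"
        by (rule divide_root_tendsto_0[OF Suc.prems(1) \<alpha>(1) \<open>0 < R\<close>])
      fix n
      assume "n > N"
      then have "vabs (divide_root a \<alpha> n) * R ^ Suc n < vabs (a (Suc N)) * R ^ Suc N"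
        by (intro vabs_divide_root_less[OF Suc.prems(1) \<alpha>(1) \<open>0 < R\<close>] Suc.prems(2)) simp
      then show "vabs (divide_root a \<alpha> n) * R ^ n < vabs (divide_root a \<alpha> N) * R ^ N"
        using \<open>0 < R\<close> by (simp add: top)
    qed
    moreover have "{x. vabs x \<le> R \<and> (\<Sum>n. a n * x ^ n) = 0}
        \<subseteq> insert \<alpha> {x. vabs x \<le> R \<and> (\<Sum>n. divide_root a \<alpha> n * x ^ n) = 0}"
      using divide_root_eval[OF Suc.prems(1) \<alpha>(1) \<open>0 < R\<close> \<alpha>(2)] by auto
    ultimately show ?thesis
      using finite_subset by blast
  next
    case False
    then have "{x. vabs x \<le> R \<and> (\<Sum>n. a n * x ^ n) = 0} \<subseteq> {}"
      by blast
    then show ?thesis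
      by (rule finite_subset) simp
  qed
qed

text \<open>
  An index dominating all later ones exists because the terms tend to zero: take the last index
  whose term is at least as large as a fixed nonzero term.
\<close>

lemma finite_zeros:
  assumes lim: "(\<lambda>n. vabs (a n :: 'c) * R ^ n) \<longlonglongrightarrow> 0" and R: "0 < R" and nz: "a m \<noteq> 0"
  shows "finite {x. vabs x \<le> R \<and> (\<Sum>n. a n * x ^ n) = 0}"
proof -
  define S where "S = {n. vabs (a m) * R ^ m \<le> vabs (a n) * R ^ n}"
  have "0 < vabs (a m) * R ^ m"
    using nz R by simp
  then have "\<forall>\<^sub>F n in sequentially. vabs (a n) * R ^ n < vabs (a m) * R ^ m"
    using order_tendstoD(2)[OF lim] by blast
  then obtain M where M: "\<And>n. n \<ge> M \<Longrightarrow> vabs (a n) * R ^ n < vabs (a m) * R ^ m"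
    by (auto simp: eventually_sequentially)
  then have "S \<subseteq> {..<M}"
    unfolding S_def by (metis (no_types, lifting) lessThan_iff mem_Collect_eq not_less subsetI)
  then have fin: "finite S"
    using finite_subset by blast
  have "m \<in> S"
    by (simp add: S_def)
  then have "Max S \<in> S"
    using fin Max_in by blast
  show ?thesis
  proof (rule finite_zeros_if_dominating_index[OF lim R, of "Max S"])
    fix n
    assume "n > Max S"
    then have "n \<notin> S"
      using Max_ge[OF fin] leD by blast
    then show "vabs (a n) * R ^ n < vabs (a (Max S)) * R ^ Max S"
      using \<open>Max S \<in> S\<close> by (simp add: S_def)
  qed
qed

end

section \<open>Entire functions\<close>

lemma entire_fun_sums:
  "entire_series F \<Longrightarrow> (\<lambda>n. fps_nth F n * x ^ n) sums entire_fun F x"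
  by (simp add: entire_series_def entire_fun_def summable_sums)

lemma poly_sums: "(\<lambda>n. coeff Q n * x ^ n) sums poly Q (x::'a::valued_field)"
  unfolding poly_altdef by (rule sums_finite) (auto simp: coeff_eq_0)

lemma transcendental_entire_nth_nonzero:
  assumes "transcendental_entire F"
  obtains n where "N \<le> n" "fps_nth F n \<noteq> 0"
proof -
  have "\<not> (\<forall>n\<ge>N. fps_nth F n = 0)"
  proof
    assume zero: "\<forall>n\<ge>N. fps_nth F n = 0"
    have "F = fps_of_poly (\<Sum>i<N. monom (fps_nth F i) i)"
      by (rule fps_ext) (use zero in \<open>auto simp: coeff_sum not_less\<close>)
    then show False
      using assms by (auto simp: transcendental_entire_def)
  qed
  then show thesis
    using that by auto
qed

text \<open>
  Density of the value group supplies elements of arbitrarily large absolute value and, on every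
  interval of radii, infinitely many spheres that contain points.
\<close>

locale densely_valued = nonarchimedean dummy
  for dummy :: "'c::complete_valued_field itself" +
  assumes vabs_dense: "0 < r \<Longrightarrow> r < s \<Longrightarrow> \<exists>x::'c. r < vabs x \<and> vabs x < s"
begin

text \<open>
  The radius \<open>R\<close> need not be an absolute value; convergence at a point outside the disc of radius
  \<open>R\<close> suffices.
\<close>

lemma entire_tendsto_0:
  assumes "entire_series (F :: 'c fps)" and "0 \<le> R"
  shows "(\<lambda>n. vabs (fps_nth F n) * R ^ n) \<longlonglongrightarrow> 0"
proof -
  obtain z :: 'c where z: "R + 1 < vabs z"
    using vabs_dense[of "R + 1" "R + 2"] assms(2) by auto
  have "(\<lambda>n. vabs (fps_nth F n * z ^ n)) \<longlonglongrightarrow> 0"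
    using assms(1) by (intro summable_vabs_tendsto_0) (simp add: entire_series_def)
  then show ?thesis
    by (rule Lim_null_comparison[rotated])
       (use assms(2) z in \<open>auto simp: vabs_mult vabs_power intro!: always_eventually mult_left_mono power_mono\<close>)
qed

lemma entire_fun_bounded:
  assumes "entire_series (F :: 'c fps)" and "0 \<le> R"
  obtains C where "\<And>x. vabs x \<le> R \<Longrightarrow> vabs (entire_fun F x) < C"
proof -
  have "Bseq (\<lambda>n. vabs (fps_nth F n) * R ^ n)"
    using entire_tendsto_0[OF assms] by (intro convergent_imp_Bseq) (auto simp: convergent_def)
  then obtain C where C: "0 < C" "\<And>n. norm (vabs (fps_nth F n) * R ^ n) \<le> C"
    by (auto simp: Bseq_def)
  have "vabs (entire_fun F x) < C + 1" if "vabs x \<le> R" for x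
  proof (rule vabs_sums_less[OF entire_fun_sums[OF assms(1)]])
    fix n
    have "vabs (fps_nth F n * x ^ n) \<le> vabs (fps_nth F n) * R ^ n"
      using that by (auto simp: vabs_mult vabs_power intro!: mult_left_mono power_mono)
    also have "\<dots> < C + 1"
      using C(2)[of n] by simp
    finally show "vabs (fps_nth F n * x ^ n) < C + 1" .
  qed (use C in simp)
  then show thesis
    using that by blast
qed

lemma finite_coincidences_with_poly:
  assumes F: "transcendental_entire (F :: 'c fps)"
  shows "finite {x. vabs x \<le> R \<and> entire_fun F x = poly Q x}"
proof -
  define G where "G = F - fps_of_poly Q"
  have ent: "entire_series F" and "F \<noteq> fps_of_poly Q"
    using F by (auto simp: transcendental_entire_def)
  then have "G \<noteq> 0"
    by (simp add: G_def)
  then obtain m where m: "fps_nth G m \<noteq> 0"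
    by (auto simp: fps_eq_iff)
  have sums: "(\<lambda>n. fps_nth G n * x ^ n) sums (entire_fun F x - poly Q x)" for x
    using tendsto_diff[OF entire_fun_sums[OF ent, unfolded sums_def] poly_sums[unfolded sums_def], of x Q x]
    by (simp add: sums_def G_def left_diff_distrib sum_subtractf)
  then have "entire_series G"
    by (auto simp: entire_series_def summable_def)
  then have "finite {x. vabs x \<le> max 1 R \<and> (\<Sum>n. fps_nth G n * x ^ n) = 0}"
    by (intro finite_zeros[where a = "fps_nth G" and m = m] entire_tendsto_0) (use m in auto)
  moreover have "(\<Sum>n. fps_nth G n * x ^ n) = entire_fun F x - poly Q x" for x
    using sums sums_unique by metis
  ultimately show ?thesis
    by (elim finite_subset[rotated]) auto
qed

section \<open>Commuting with an affine map\<close>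

text \<open>
  The points \<open>c + e\<^sup>k\<close> lie in a fixed disc, and the function agrees on them with the affine map
  \<open>x \<mapsto> c + l (x - c)\<close>. If \<open>e\<close> were not a root of unity, they would be infinitely many.
\<close>

lemma root_of_unity_if_scaled_values:
  assumes F: "transcendental_entire (F :: 'c fps)" and e: "e \<noteq> 0" "vabs e \<le> 1"
    and eq: "\<And>k. entire_fun F (c + e ^ k) = c + e ^ k * l"
  shows "\<exists>n>0. e ^ n = 1"
proof (rule ccontr)
  assume no_root: "\<not> ?thesis"
  have "inj (\<lambda>k::nat. c + e ^ k)"
  proof (rule linorder_injI)
    fix i k :: nat
    assume "i < k"
    then have "e ^ k = e ^ i * e ^ (k - i)"
      by (simp flip: power_add)
    moreover have "e ^ (k - i) \<noteq> 1"
      using no_root zero_less_diff[of k i] \<open>i < k\<close> by blast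
    ultimately show "c + e ^ i \<noteq> c + e ^ k"
      using e(1) by simp
  qed
  then have inf: "infinite (range (\<lambda>k::nat. c + e ^ k))"
    using finite_imageD by blast
  have "vabs (c + e ^ k) \<le> vabs c + 1" for k
    using vabs_triangle[of c "e ^ k"] power_le_one[OF vabs_nonneg e(2), of k] by (simp add: vabs_power)
  moreover have "entire_fun F (c + e ^ k) = poly [:c - l * c, l:] (c + e ^ k)" for k
    by (simp add: eq algebra_simps)
  ultimately have "range (\<lambda>k. c + e ^ k)
      \<subseteq> {x. vabs x \<le> vabs c + 1 \<and> entire_fun F x = poly [:c - l * c, l:] x}"
    by blast
  then show False
    using finite_coincidences_with_poly[OF F] inf finite_subset by blast
qed

text \<open>
  Centred at the fixed point \<open>c\<close> of \<open>x \<mapsto> a x + b\<close>, the functional equation says \<open>g (a y) = a g (y)\<close>,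
  which determines \<open>g\<close> on the orbit of \<open>1\<close> under multiplication by \<open>a\<close>. When \<open>|a| > 1\<close> the backward
  orbit is used, since it is the one that stays bounded.
\<close>

lemma root_of_unity_if_commutes_with_affine:
  assumes F: "transcendental_entire (F :: 'c fps)" and a: "a \<noteq> 0"
    and comm: "\<And>x. entire_fun F (a * x + b) = a * entire_fun F x + b"
  shows "\<exists>n>0. a ^ n = 1"
proof (cases "a = 1")
  case False
  define c where "c = b / (1 - a)"
  define g where "g y = entire_fun F (c + y) - c" for y
  have c: "a * c + b = c"
    using False by (simp add: c_def field_simps)
  have g: "g (a * y) = a * g y" for y
  proof -
    have "a * (c + y) + b = c + a * y"
      using c by (simp add: algebra_simps)
    then have "entire_fun F (c + a * y) = a * entire_fun F (c + y) + b"
      using comm[of "c + y"] by simp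
    moreover have "b = c - a * c"
      using c by (metis add_diff_cancel_left')
    ultimately show ?thesis
      by (simp add: g_def algebra_simps)
  qed
  define e where "e = (if vabs a \<le> 1 then a else inverse a)"
  have e: "e \<noteq> 0" "vabs e \<le> 1"
    using a by (auto simp: e_def vabs_inverse inverse_le_1_iff)
  have "g (inverse a * y) = inverse a * g y" for y
    using g[of "inverse a * y"] a by (simp add: field_simps)
  then have ge: "g (e * y) = e * g y" for y
    using g by (simp add: e_def)
  have "g (e ^ k) = e ^ k * g 1" for k
    by (induction k) (simp_all add: ge)
  then have "entire_fun F (c + e ^ k) = c + e ^ k * g 1" for k
    by (simp add: g_def algebra_simps)
  then have "\<exists>n>0. e ^ n = 1"
    by (rule root_of_unity_if_scaled_values[OF F e])
  then show ?thesis
    by (auto simp: e_def power_inverse split: if_splits)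
qed auto

section \<open>Growth on spheres\<close>

text \<open>
  On the sphere of radius \<open>s\<close> a nonzero entire function has absolute value \<open>max |a\<^sub>n| s\<^sup>n\<close>, unless the
  maximum is attained twice. In that case \<open>|a\<^sub>m| s\<^sup>m = |a\<^sub>n| s\<^sup>n\<close>, an equation that determines \<open>s\<close>. Only finitely
  many pairs of indices occur: with \<open>a\<^sub>q \<noteq> 0\<close> and radii in \<open>[1, R]\<close>, the maximum is at least
  \<open>|a\<^sub>q|\<close>, which exceeds \<open>|a\<^sub>n| R\<^sup>n\<close> for all large \<open>n\<close>.
\<close>

lemma finite_exceptional_radii:
  assumes ent: "entire_series (F :: 'c fps)"
  shows "finite {vabs x |x. 1 \<le> vabs x \<and> vabs x \<le> R \<and>
    (\<exists>k. vabs (entire_fun F x) < vabs (fps_nth F k) * vabs x ^ k)}" (is "finite ?X")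
proof (cases "F = 0 \<or> R < 1")
  case True
  then have "?X \<subseteq> {}"
    by auto
  then show ?thesis
    by (rule finite_subset) simp
next
  case False
  then have R: "1 \<le> R"
    by simp
  define u where "u s n = vabs (fps_nth F n) * s ^ n" for s n
  obtain q where q: "fps_nth F q \<noteq> 0"
    using False by (auto simp: fps_eq_iff)
  then have "0 < vabs (fps_nth F q)"
    by simp
  then have "\<forall>\<^sub>F n in sequentially. vabs (fps_nth F n) * R ^ n < vabs (fps_nth F q)"
    using order_tendstoD(2)[OF entire_tendsto_0[OF ent, of R]] R by auto
  then obtain M where M: "\<And>n. n \<ge> M \<Longrightarrow> vabs (fps_nth F n) * R ^ n < vabs (fps_nth F q)"
    by (auto simp: eventually_sequentially)
  define T where "T m n = {s. 1 \<le> s \<and> fps_nth F m \<noteq> 0 \<and> u s m = u s n}" for m n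
  have fin_T: "finite (T m n)" if "m < n" for m n
  proof -
    have "s = t" if s: "s \<in> T m n" and t: "t \<in> T m n" for s t
    proof -
      have "vabs (fps_nth F m) = vabs (fps_nth F n) * r ^ (n - m)" if "r \<in> T m n" for r
      proof -
        have "vabs (fps_nth F m) * r ^ m = vabs (fps_nth F n) * r ^ (n - m) * r ^ m"
          using that \<open>m < n\<close> by (simp add: T_def u_def flip: power_add)
        then show ?thesis
          using that by (auto simp: T_def)
      qed
      note this[OF s] this[OF t]
      moreover have "fps_nth F m \<noteq> 0"
        using s by (simp add: T_def)
      ultimately have "s ^ (n - m) = t ^ (n - m)"
        by (metis mult_cancel_left mult_zero_left vabs_eq_0)
      then show "s = t"
        using s t \<open>m < n\<close> power_eq_imp_eq_base[of s "n - m" t] by (auto simp: T_def)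
    qed
    then have "T m n \<subseteq> {s} \<or> T m n = {}" if "s \<in> T m n" for s
      using that by blast
    then show ?thesis
      by (metis finite.simps finite_subset ex_in_conv)
  qed
  have "?X \<subseteq> (\<Union>n<M. \<Union>m<n. T m n)"
  proof
    fix s
    assume "s \<in> ?X"
    then obtain x k where x: "s = vabs x" "1 \<le> s" "s \<le> R" and k: "vabs (entire_fun F x) < u s k"
      by (auto simp: u_def)
    have small: "u s n < u s q" if "n \<ge> M" for n
    proof -
      have "u s n \<le> vabs (fps_nth F n) * R ^ n"
        using x by (auto simp: u_def intro!: mult_left_mono power_mono)
      also have "\<dots> < vabs (fps_nth F q)"
        by (rule M[OF that])
      also have "\<dots> \<le> u s q"
        using x by (simp add: u_def mult_le_cancel_left1)
      finally show ?thesis .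
    qed
    have "q < M"
      using small[of q] by (meson less_irrefl not_less)
    have fin: "finite (u s ` {..<M})" and "u s ` {..<M} \<noteq> {}"
      using \<open>q < M\<close> by auto
    then have "Max (u s ` {..<M}) \<in> u s ` {..<M}"
      by (rule Max_in)
    then obtain n where n: "n < M" "u s n = Max (u s ` {..<M})"
      by auto
    have max_M: "u s m \<le> u s n" if "m < M" for m
      unfolding n(2) using that by (intro Max_ge fin) auto
    have max: "u s m \<le> u s n" for m
      using max_M small[of m] max_M[OF \<open>q < M\<close>] by (cases "m < M") (auto simp: not_less)
    have "\<exists>m. m \<noteq> n \<and> u s n \<le> u s m"
    proof (rule ccontr)
      assume "\<not> ?thesis"
      then have "vabs (fps_nth F m * x ^ m) < vabs (fps_nth F n * x ^ n)" if "m \<noteq> n" for m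
        using that by (auto simp: u_def x(1) vabs_mult vabs_power not_le)
      then have "vabs (entire_fun F x) = vabs (fps_nth F n * x ^ n)"
        by (rule vabs_sums_dominant[OF entire_fun_sums[OF ent]])
      then show False
        using k max[of k] by (simp add: u_def x(1) vabs_mult vabs_power)
    qed
    then obtain m where m: "m \<noteq> n" "u s n \<le> u s m"
      by blast
    then have eq: "u s m = u s n"
      using max[of m] by simp
    have "m < M"
      using small[of m] m(2) max[of q] by (meson leI less_le_trans not_less)
    have "0 < u s q"
      using x(2) \<open>0 < vabs (fps_nth F q)\<close> by (simp add: u_def)
    then have "0 < u s n"
      using max[of q] by simp
    then have "fps_nth F n \<noteq> 0" "fps_nth F m \<noteq> 0"
      using eq x(2) by (auto simp: u_def)
    then have "s \<in> T m n" "s \<in> T n m"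
      using x(2) eq by (auto simp: T_def)
    then show "s \<in> (\<Union>n<M. \<Union>m<n. T m n)"
      using m(1) n(1) \<open>m < M\<close> by (cases "m < n") (force, force simp: not_less le_less)
  qed
  then show ?thesis
    by (rule finite_subset) (auto intro: fin_T)
qed

text \<open>
  Far out, the leading term dominates; any radius exceeding the sum of the absolute values of all
  coefficients, relative to the leading one, will do.
\<close>

lemma vabs_poly_large:
  assumes "Q \<noteq> (0 :: 'c poly)"
  obtains E where "1 \<le> E"
    "\<And>x. E \<le> vabs x \<Longrightarrow> vabs (poly Q x) = vabs (lead_coeff Q) * vabs x ^ degree Q"
proof -
  define A where "A = vabs (lead_coeff Q)"
  define S where "S = (\<Sum>i\<le>degree Q. vabs (coeff Q i))"
  have A: "0 < A"
    using assms by (simp add: A_def)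
  have S: "0 \<le> S"
    by (simp add: S_def sum_nonneg)
  have "vabs (poly Q x) = A * vabs x ^ degree Q" if x: "1 + S / A \<le> vabs x" for x
  proof -
    have x1: "1 \<le> vabs x"
      using x S A by (smt (verit) divide_nonneg_pos)
    have "S < A * vabs x"
      using x A by (simp add: field_simps)
    have "vabs (poly Q x) = vabs (coeff Q (degree Q) * x ^ degree Q)"
    proof (rule vabs_sums_dominant[OF poly_sums])
      fix i
      assume i: "i \<noteq> degree Q"
      show "vabs (coeff Q i * x ^ i) < vabs (coeff Q (degree Q) * x ^ degree Q)"
      proof (cases "i < degree Q")
        case True
        have "vabs (coeff Q i) \<le> S"
          unfolding S_def using True by (intro member_le_sum) auto
        then have "vabs (coeff Q i * x ^ i) < A * vabs x * vabs x ^ i"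
          unfolding vabs_mult vabs_power
          by (intro mult_strict_right_mono zero_less_power) (use x1 \<open>S < A * vabs x\<close> in linarith)+
        also have "\<dots> = A * vabs x ^ Suc i"
          by simp
        also have "\<dots> \<le> A * vabs x ^ degree Q"
          using True x1 A by (intro mult_left_mono power_increasing) auto
        finally show ?thesis
          by (simp add: A_def vabs_mult vabs_power)
      next
        case False
        moreover have "x \<noteq> 0"
          using x1 by auto
        ultimately show ?thesis
          using i mult_pos_pos[OF A zero_less_power[of "vabs x" "degree Q"]] x1
          by (simp add: coeff_eq_0 vabs_mult vabs_power A_def)
      qed
    qed
    then show ?thesis
      by (simp add: A_def vabs_mult vabs_power)
  qed
  then show thesis
    using that[of "1 + S / A"] S A by (simp add: A_def)
qed

lemma vabs_poly_le:
  "vabs (poly Q (y::'c)) \<le> (\<Sum>i\<le>degree Q. vabs (coeff Q i)) * max 1 (vabs y) ^ degree Q"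
proof -
  have "vabs (poly Q y) \<le> (\<Sum>i\<le>degree Q. vabs (coeff Q i * y ^ i))"
    unfolding poly_altdef by (rule vabs_sum)
  also have "\<dots> \<le> (\<Sum>i\<le>degree Q. vabs (coeff Q i) * max 1 (vabs y) ^ degree Q)"
  proof (rule sum_mono)
    fix i
    assume "i \<in> {..degree Q}"
    have "vabs y ^ i \<le> max 1 (vabs y) ^ i"
      by (intro power_mono) auto
    also have "\<dots> \<le> max 1 (vabs y) ^ degree Q"
      using \<open>i \<in> {..degree Q}\<close> by (intro power_increasing) auto
    finally show "vabs (coeff Q i * y ^ i) \<le> vabs (coeff Q i) * max 1 (vabs y) ^ degree Q"
      by (simp add: vabs_mult vabs_power mult_left_mono)
  qed
  finally show ?thesis
    by (simp add: sum_distrib_right)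
qed

section \<open>Commuting with a polynomial of higher degree\<close>

lemma infinite_vabs_between:
  assumes "0 < r" "r < s"
  shows "infinite {t. r < t \<and> t < s \<and> t \<in> range (vabs :: 'c \<Rightarrow> real)}" (is "infinite ?V")
proof
  assume fin: "finite ?V"
  obtain x :: 'c where "r < vabs x" "vabs x < s"
    using vabs_dense[OF assms] by blast
  then have "?V \<noteq> {}"
    by auto
  then have min: "Min ?V \<in> ?V"
    using fin by (intro Min_in)
  then obtain y :: 'c where y: "r < vabs y" "vabs y < Min ?V"
    using vabs_dense[of r "Min ?V"] assms(1) by auto
  then have "vabs y \<in> ?V"
    using min by auto
  then show False
    using Min_le[OF fin] y(2) by fastforce
qed

text \<open>
  Suppose that \<open>d = degree P\<close> is at least \<open>2\<close> and follow the orbit \<open>x\<^sub>k = P\<^sup>k(x)\<close> of a point with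
  \<open>|x|\<close> large. With a suitable constant \<open>E\<close>, the quotient \<open>|x\<^sub>k| / E\<close> is at least \<open>|x| / E\<close> to the power \<open>d\<^sup>k\<close>. Since
  \<open>f(x\<^sub>k) = P\<^sup>k(f(x))\<close>, the values of \<open>f\<close> grow at most like a constant to the power \<open>d\<^sup>k\<close>, so
  \<open>|f(x\<^sub>k)| \<le> |x\<^sub>k|\<^sup>N\<close> with the same exponent \<open>N\<close> for all \<open>k\<close> and all \<open>x\<close> in an annulus.
  As \<open>f\<close> is transcendental, it has a nonzero coefficient \<open>a\<^sub>n\<close> with \<open>n > N\<close>, and for large \<open>k\<close> the bound
  is smaller than \<open>|a\<^sub>n| |x\<^sub>k|\<^sup>n\<close>. Hence \<open>|x\<^sub>k|\<close> is an exceptional radius of \<open>f\<close>. For fixed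
  \<open>k\<close> the radius \<open>|x\<^sub>k|\<close> is an injective function of \<open>|x|\<close>, so infinitely many values of \<open>|x|\<close> in the
  annulus give infinitely many exceptional radii in a bounded interval, which is impossible.
\<close>

lemma degree_le_1_if_commutes:
  assumes F: "transcendental_entire (F :: 'c fps)"
    and comm: "\<And>x. poly P (entire_fun F x) = entire_fun F (poly P x)"
  shows "degree P \<le> 1"
proof (rule ccontr)
  define d where "d = degree P"
  define A where "A = vabs (lead_coeff P)"
  define K where "K = 1 + (\<Sum>i\<le>d. vabs (coeff P i))"
  assume "\<not> ?thesis"
  then have d: "2 \<le> d"
    by (simp add: d_def)
  then have "P \<noteq> 0"
    by (auto simp: d_def)
  then have A: "0 < A"
    by (simp add: A_def)
  have K: "1 \<le> K"
    by (simp add: K_def sum_nonneg)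
  have ent: "entire_series F"
    using F by (simp add: transcendental_entire_def)
  obtain E0 where E0: "1 \<le> E0" "\<And>x. E0 \<le> vabs x \<Longrightarrow> vabs (poly P x) = A * vabs x ^ d"
    using vabs_poly_large[OF \<open>P \<noteq> 0\<close>] by (auto simp: A_def d_def)
  define E where "E = max E0 (1 / A)"
  have E: "1 \<le> E" "1 / A \<le> E"
    using E0(1) by (auto simp: E_def)
  have P_large: "vabs (poly P x) = A * vabs x ^ d" if "E \<le> vabs x" for x
    using that E0(2) by (simp add: E_def)
  have AE: "1 \<le> A * E ^ (d - 1)"
  proof -
    have "1 \<le> A * E"
      using E(2) A by (simp add: field_simps)
    also have "\<dots> \<le> A * E ^ (d - 1)"
      using A E(1) d power_increasing[of 1 "d - 1" E] by simp
    finally show ?thesis .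
  qed

  \<comment> \<open>With this normalisation one step of the iteration raises the bound to the power \<open>d\<close>.\<close>
  define g where "g y = K * max 1 (vabs y)" for y :: 'c
  have g_step: "g (poly P y) \<le> g y ^ d" for y
  proof -
    have "vabs (poly P y) \<le> (K - 1) * max 1 (vabs y) ^ d"
      using vabs_poly_le[of P y] by (simp add: K_def d_def)
    also have "\<dots> \<le> K * max 1 (vabs y) ^ d"
      by (intro mult_right_mono) auto
    finally have "max 1 (vabs (poly P y)) \<le> K * max 1 (vabs y) ^ d"
      using mult_mono[OF K one_le_power[of "max 1 (vabs y)" d]] K by simp
    then have "g (poly P y) \<le> K ^ 2 * max 1 (vabs y) ^ d"
      using K by (simp add: g_def power2_eq_square mult.assoc)
    also have "\<dots> \<le> K ^ d * max 1 (vabs y) ^ d"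
      using K d by (intro mult_right_mono power_increasing) auto
    finally show ?thesis
      by (simp add: g_def power_mult_distrib)
  qed
  have g_iter: "g ((poly P ^^ k) y) \<le> g y ^ (d ^ k)" for k y
  proof (induction k)
    case (Suc k)
    have "g ((poly P ^^ Suc k) y) \<le> g ((poly P ^^ k) y) ^ d"
      using g_step by simp
    also have "\<dots> \<le> (g y ^ (d ^ k)) ^ d"
      using Suc K by (intro power_mono) (auto simp: g_def)
    finally show ?case
      by (simp add: mult.commute flip: power_mult)
  qed simp

  \<comment> \<open>Dually, \<open>|x| / E\<close> is at least raised to the power \<open>d\<close>, by the choice \<open>1 \<le> A E\<^sup>d\<^sup>-\<^sup>1\<close>.\<close>
  have x_step: "(vabs x / E) ^ d \<le> vabs (poly P x) / E" if "E \<le> vabs x" for x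
  proof -
    have "E ^ d = E ^ (d - 1) * E"
      using d by (simp flip: power_Suc2)
    then have "A * vabs x ^ d / E = (A * E ^ (d - 1)) * (vabs x / E) ^ d"
      using E(1) by (simp add: power_divide)
    moreover have "1 * (vabs x / E) ^ d \<le> (A * E ^ (d - 1)) * (vabs x / E) ^ d"
      using AE E(1) by (intro mult_right_mono) auto
    ultimately show ?thesis
      using P_large[OF that] by simp
  qed
  have x_iter: "E \<le> vabs ((poly P ^^ k) x) \<and> (vabs x / E) ^ (d ^ k) \<le> vabs ((poly P ^^ k) x) / E"
    if x: "E \<le> vabs x" for k x
  proof (induction k)
    case (Suc k)
    let ?y = "(poly P ^^ k) x"
    have "(vabs x / E) ^ (d ^ Suc k) = ((vabs x / E) ^ (d ^ k)) ^ d"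
      by (simp add: mult.commute flip: power_mult)
    also have "\<dots> \<le> (vabs ?y / E) ^ d"
      using Suc E(1) by (intro power_mono) auto
    also have "\<dots> \<le> vabs (poly P ?y) / E"
      using Suc by (intro x_step) simp
    finally have bound: "(vabs x / E) ^ (d ^ Suc k) \<le> vabs ((poly P ^^ Suc k) x) / E"
      by simp
    moreover have "1 \<le> (vabs x / E) ^ (d ^ Suc k)"
      using x E(1) by (intro one_le_power) auto
    ultimately have "1 \<le> vabs ((poly P ^^ Suc k) x) / E"
      by linarith
    then have "E \<le> vabs ((poly P ^^ Suc k) x)"
      using E(1) by (simp add: le_divide_eq)
    with bound show ?case
      by blast
  qed (use x in auto)
  have x_monomial: "\<exists>B>0. \<forall>x. E \<le> vabs x \<longrightarrow> vabs ((poly P ^^ k) x) = B * vabs x ^ (d ^ k)" for k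
  proof (induction k)
    case 0
    show ?case
      by (intro exI[of _ 1]) simp
  next
    case (Suc k)
    then obtain B where B: "0 < B" "\<And>x. E \<le> vabs x \<Longrightarrow> vabs ((poly P ^^ k) x) = B * vabs x ^ (d ^ k)"
      by blast
    have "vabs ((poly P ^^ Suc k) x) = (A * B ^ d) * vabs x ^ (d ^ Suc k)" if "E \<le> vabs x" for x
      using P_large[OF conjunct1[OF x_iter[OF that, of k]]] B(2)[OF that]
      by (simp add: power_mult_distrib mult.commute flip: power_mult)
    then show ?case
      using A B(1) by (intro exI[of _ "A * B ^ d"]) simp
  qed
  have comm_iter: "entire_fun F ((poly P ^^ k) x) = (poly P ^^ k) (entire_fun F x)" for k x
    by (induction k) (simp_all flip: comm)

  obtain C where C: "\<And>x. vabs x \<le> 3 * E \<Longrightarrow> vabs (entire_fun F x) < C"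
    using entire_fun_bounded[OF ent, of "3 * E"] E(1) by auto
  \<comment> \<open>The annulus \<open>2 E \<le> |x| \<le> 3 E\<close> makes \<open>|x| / E \<ge> 2\<close>, so that a power of it absorbs any constant.\<close>
  obtain N where N: "K * max 1 C < 2 ^ N"
    using real_arch_pow[of 2] by auto
  have upper: "vabs (entire_fun F ((poly P ^^ k) x)) \<le> vabs ((poly P ^^ k) x) ^ N"
    if x: "2 * E \<le> vabs x" "vabs x \<le> 3 * E" for k x
  proof -
    have xE: "E \<le> vabs x"
      using x E(1) by simp
    have "g (entire_fun F x) \<le> K * max 1 C"
      using C[OF x(2)] K by (simp add: g_def)
    also have "\<dots> \<le> 2 ^ N"
      using N by simp
    also have "\<dots> \<le> (vabs x / E) ^ N"
      using x E(1) by (intro power_mono) (auto simp: field_simps)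
    finally have start: "g (entire_fun F x) \<le> (vabs x / E) ^ N" .
    have "vabs (entire_fun F ((poly P ^^ k) x)) \<le> 1 * max 1 (vabs ((poly P ^^ k) (entire_fun F x)))"
      by (simp add: comm_iter)
    also have "\<dots> \<le> g ((poly P ^^ k) (entire_fun F x))"
      unfolding g_def using K by (intro mult_right_mono) auto
    also have "\<dots> \<le> g (entire_fun F x) ^ (d ^ k)"
      by (rule g_iter)
    also have "\<dots> \<le> ((vabs x / E) ^ N) ^ (d ^ k)"
      using start K by (intro power_mono) (auto simp: g_def)
    also have "\<dots> = ((vabs x / E) ^ (d ^ k)) ^ N"
      by (simp add: mult.commute flip: power_mult)
    also have "\<dots> \<le> (vabs ((poly P ^^ k) x) / E) ^ N"
      using x_iter[OF xE, of k] E(1) by (intro power_mono) auto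
    also have "\<dots> \<le> vabs ((poly P ^^ k) x) ^ N"
      using E(1) by (intro power_mono) (auto simp: divide_le_eq mult_le_cancel_left1)
    finally show ?thesis .
  qed

  obtain n where n: "Suc N \<le> n" "fps_nth F n \<noteq> 0"
    using transcendental_entire_nth_nonzero[OF F] by blast
  then have an: "0 < vabs (fps_nth F n)"
    by simp
  obtain k where k: "1 / vabs (fps_nth F n) < 2 ^ k"
    using real_arch_pow[of 2] by auto
  obtain B where B: "0 < B" "\<And>x. E \<le> vabs x \<Longrightarrow> vabs ((poly P ^^ k) x) = B * vabs x ^ (d ^ k)"
    using x_monomial by blast
  let ?V = "{t. 2 * E < t \<and> t < 3 * E \<and> t \<in> range (vabs :: 'c \<Rightarrow> real)}"
  let ?X = "{vabs x |x. 1 \<le> vabs x \<and> vabs x \<le> B * (3 * E) ^ (d ^ k) \<and>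
    (\<exists>k. vabs (entire_fun F x) < vabs (fps_nth F k) * vabs x ^ k)}"
  have "(\<lambda>t. B * t ^ (d ^ k)) ` ?V \<subseteq> ?X"
  proof (rule image_subsetI)
    fix t
    assume "t \<in> ?V"
    then obtain x :: 'c where x: "t = vabs x" "2 * E \<le> vabs x" "vabs x \<le> 3 * E"
      by auto
    then have xE: "E \<le> vabs x"
      using E(1) by simp
    let ?y = "(poly P ^^ k) x"
    have y1: "1 \<le> vabs ?y"
      using x_iter[OF xE, of k] E(1) by simp
    have "k < d ^ k"
      using less_exp[of k] power_mono[OF d, of k] by linarith
    then have "(2::real) ^ k \<le> 2 ^ (d ^ k)"
      by (intro power_increasing) auto
    also have "\<dots> \<le> (vabs x / E) ^ (d ^ k)"
      using x E(1) by (intro power_mono) (auto simp: field_simps)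
    also have "\<dots> \<le> vabs ?y"
      using x_iter[OF xE, of k] E(1) by (smt (verit) divide_le_eq mult_le_cancel_left1)
    finally have "1 / vabs (fps_nth F n) < vabs ?y"
      using k by simp
    then have "1 < vabs (fps_nth F n) * vabs ?y"
      using an by (simp add: field_simps)
    then have "1 * vabs ?y ^ N < vabs (fps_nth F n) * vabs ?y * vabs ?y ^ N"
      by (intro mult_strict_right_mono zero_less_power) (use y1 in linarith)+
    also have "\<dots> = vabs (fps_nth F n) * vabs ?y ^ Suc N"
      by simp
    also have "\<dots> \<le> vabs (fps_nth F n) * vabs ?y ^ n"
      using n(1) y1 by (intro mult_left_mono power_increasing) auto
    finally have "vabs (entire_fun F ?y) < vabs (fps_nth F n) * vabs ?y ^ n"
      using upper[OF x(2,3), of k] by simp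
    moreover have "vabs ?y \<le> B * (3 * E) ^ (d ^ k)"
      unfolding B(2)[OF xE] using B(1) x(3) by (intro mult_left_mono power_mono) auto
    moreover have "B * t ^ (d ^ k) = vabs ?y"
      using B(2)[OF xE] x(1) by simp
    ultimately show "B * t ^ (d ^ k) \<in> ?X"
      using y1 by blast
  qed
  then have "finite ((\<lambda>t. B * t ^ (d ^ k)) ` ?V)"
    using finite_exceptional_radii[OF ent] finite_subset by blast
  moreover have "inj_on (\<lambda>t. B * t ^ (d ^ k)) ?V"
  proof (rule inj_onI)
    fix s t
    assume "s \<in> ?V" "t \<in> ?V" "B * s ^ (d ^ k) = B * t ^ (d ^ k)"
    then show "s = t"
      using B(1) E(1) d power_eq_imp_eq_base[of s "d ^ k" t] by auto
  qed
  ultimately have "finite ?V"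
    by (rule finite_imageD)
  then show False
    using infinite_vabs_between[of "2 * E" "3 * E"] E(1) by simp
qed

end

section \<open>Absolute values of complex \<open>p\<close>-adic numbers\<close>

lemma field_embedding_of_nat:
  assumes "field_embedding \<iota>"
  shows "\<iota> (of_nat n) = of_nat n"
proof -
  have "\<iota> 0 = 0"
    using assms unfolding field_embedding_def by (metis add_cancel_right_right)
  then show ?thesis
    using assms by (induction n) (auto simp: field_embedding_def)
qed

lemma field_embedding_power:
  assumes "field_embedding \<iota>"
  shows "\<iota> (x ^ n) = \<iota> x ^ n"
  using assms by (induction n) (auto simp: field_embedding_def)

lemma padic_abs_of_nat:
  assumes "n \<noteq> 0"
  shows "padic_abs p (of_nat n) = 1 / real p ^ multiplicity (int p) (int n)"
proof -
  have "quotient_of (of_nat n) = (int n, 1)"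
    using quotient_of_int[of "int n"] by simp
  then show ?thesis
    using assms by (simp add: padic_abs_def power_int_minus divide_inverse)
qed

text \<open>
  The powers of \<open>max |x| |y|\<close> bound \<open>|x + y|\<^sup>n\<close> up to the factor \<open>n + 1\<close>, by the binomial theorem;
  this factor is of subexponential growth and so disappears on taking \<open>n\<close>-th roots.
\<close>

lemma ultrametric_if_vabs_of_nat_le_1:
  fixes x y :: "'c::valued_field"
  assumes le_1: "\<And>n. vabs (of_nat n :: 'c) \<le> 1"
  shows "vabs (x + y) \<le> max (vabs x) (vabs y)"
proof (rule ccontr)
  define M where "M = max (vabs x) (vabs y)"
  assume "\<not> ?thesis"
  then have less: "M < vabs (x + y)"
    by (simp only: M_def not_le)
  have M0: "0 \<le> M"
    by (simp add: M_def le_max_iff_disj)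
  have bound: "vabs (x + y) ^ n \<le> real (Suc n) * M ^ n" for n
  proof -
    have "vabs (x + y) ^ n = vabs (\<Sum>k\<le>n. of_nat (n choose k) * x ^ k * y ^ (n - k))"
      by (simp only: binomial_ring flip: vabs_power)
    also have "\<dots> \<le> (\<Sum>k\<le>n. vabs (of_nat (n choose k) * x ^ k * y ^ (n - k)))"
      by (rule vabs_sum)
    also have "\<dots> \<le> (\<Sum>k\<le>n. M ^ n)"
    proof (rule sum_mono)
      fix k
      assume "k \<in> {..n}"
      have "vabs (of_nat (n choose k) * x ^ k * y ^ (n - k)) \<le> 1 * M ^ k * M ^ (n - k)"
        unfolding vabs_mult vabs_power
        by (intro mult_mono power_mono le_1) (auto simp: M_def M0[unfolded M_def])
      then show "vabs (of_nat (n choose k) * x ^ k * y ^ (n - k)) \<le> M ^ n"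
        using \<open>k \<in> {..n}\<close> by (simp flip: power_add)
    qed
    finally show ?thesis
      by simp
  qed
  have "M \<noteq> 0"
    using bound[of 1] less M0 by auto
  with M0 have "0 < M"
    by simp
  define q where "q = M / vabs (x + y)"
  have pos: "0 < vabs (x + y)"
    using \<open>0 < M\<close> less by linarith
  have q: "0 < q" "q < 1"
    using pos \<open>0 < M\<close> less by (simp_all only: q_def divide_pos_pos divide_less_eq_1_pos)
  have "(\<lambda>n. real n * q ^ n + q ^ n) \<longlonglongrightarrow> 0 + 0"
    using q by (intro tendsto_add LIMSEQ_power_zero powser_times_n_limit_0) auto
  then have "\<forall>\<^sub>F n in sequentially. real n * q ^ n + q ^ n < 1"
    by (rule order_tendstoD) simp
  then obtain n where "real (Suc n) * q ^ n < 1"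
    by (auto simp: eventually_sequentially algebra_simps)
  then have "real (Suc n) * M ^ n / vabs (x + y) ^ n < 1"
    by (simp add: q_def power_divide)
  then have "real (Suc n) * M ^ n < vabs (x + y) ^ n"
    by (simp only: divide_less_eq_1_pos[OF zero_less_power[OF pos]])
  then show False
    using bound[of n] by simp
qed

context
  fixes p :: nat
    and \<iota> :: "rat \<Rightarrow> 'q::complete_valued_field"
    and w :: "'q alg_closure \<Rightarrow> real"
    and j :: "'q alg_closure \<Rightarrow> 'c::complete_valued_field"
  assumes prime: "prime p" and Cp: "is_Cp p \<iota> w j"
begin

lemma
  shows \<iota>_embedding: "field_embedding \<iota>" and vabs_\<iota>: "vabs (\<iota> r) = padic_abs p r"
    and j_embedding: "field_embedding j" and vabs_j: "vabs (j x) = w x"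
    and w_to_ac: "w (to_ac z) = vabs z"
  using Cp by (auto simp: is_Cp_def is_completion_def)

lemma vabs_of_nat_Cp:
  "n \<noteq> 0 \<Longrightarrow> vabs (of_nat n :: 'c) = 1 / real p ^ multiplicity (int p) (int n)"
  using vabs_j[of "of_nat n"] w_to_ac[of "of_nat n"] vabs_\<iota>[of "of_nat n"]
    field_embedding_of_nat[OF \<iota>_embedding] field_embedding_of_nat[OF j_embedding]
    padic_abs_of_nat
  by simp

text \<open>
  The absolute value of an algebraic closure is only given to extend that of \<open>\<rat>\<^sub>p\<close>; its ultrametric
  inequality is forced by the values on the natural numbers.
\<close>

lemma ultrametric_Cp: "vabs (x + y :: 'c) \<le> max (vabs x) (vabs y)"
proof (rule ultrametric_if_vabs_of_nat_le_1)
  fix n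
  show "vabs (of_nat n :: 'c) \<le> 1"
  proof (cases "n = 0")
    case False
    then show ?thesis
      using prime_ge_1_nat[OF prime] by (simp add: vabs_of_nat_Cp)
  qed auto
qed

text \<open>
  An \<open>n\<close>-th root of \<open>p\<close> has absolute value \<open>p\<^sup>-\<^sup>1\<^sup>/\<^sup>n\<close>, so every rational power of \<open>p\<close> is an
  absolute value.
\<close>

lemma vabs_dense_Cp:
  assumes "0 < r" "r < s"
  shows "\<exists>x::'c. r < vabs x \<and> vabs x < s"
proof -
  have p: "real p > 1"
    using prime_gt_1_nat[OF prime] by simp
  have "log p r < log p s"
    using assms p by simp
  then obtain q where q: "q \<in> \<rat>" "log p r < q" "q < log p s"
    using Rats_dense_in_real by blast
  then obtain m n where mn: "n > 0" "- q = of_int m / of_int n"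
    using Rats_cases'[OF Rats_minus_iff[THEN iffD2, OF q(1)]] by metis
  obtain y :: "'q alg_closure" where "y ^ nat n = of_nat p"
    using nth_root_exists[of "nat n"] mn(1) by auto
  then have "j y ^ nat n = of_nat p"
    using field_embedding_power[OF j_embedding] field_embedding_of_nat[OF j_embedding] by metis
  then have "vabs (j y) ^ nat n = vabs (of_nat p :: 'c)"
    by (metis vabs_power)
  also have "\<dots> = p powr (- 1)"
    using prime p by (simp add: vabs_of_nat_Cp powr_minus divide_inverse)
  finally have root: "vabs (j y) ^ nat n = p powr (- 1)" .
  then have pos: "vabs (j y) > 0"
    using p mn(1) by (metis less_le vabs_nonneg powr_gt_zero zero_power zero_less_nat_eq less_irrefl not_one_less_zero)
  have "vabs (j y) powr real (nat n) = p powr (- 1)"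
    using root pos by (simp add: powr_realpow)
  then have "(vabs (j y) powr real (nat n)) powr (m / n) = (p powr (- 1)) powr (m / n)"
    by simp
  moreover have "- 1 * (m / n) = q" "real (nat n) * (m / n) = m"
    using mn by (simp_all add: minus_equation_iff[of q])
  ultimately have "vabs (j y) powr m = p powr q"
    by (simp only: powr_powr)
  moreover have "\<exists>x::'c. vabs x = vabs (j y) powr m"
  proof (cases "m \<ge> 0")
    case True
    then have "vabs (j y ^ nat m) = vabs (j y) powr m"
      using pos by (simp add: vabs_power powr_realpow[symmetric])
    then show ?thesis
      by blast
  next
    case False
    then have "vabs (inverse (j y ^ nat (- m))) = vabs (j y) powr m"
      using pos by (simp add: vabs_inverse vabs_power powr_realpow[symmetric] powr_minus[symmetric])
    then show ?thesis
      by blast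
  qed
  ultimately obtain x :: 'c where "vabs x = p powr q"
    by auto
  moreover have "r < p powr q" "p powr q < s"
    using q assms p by (auto simp: log_less_iff less_log_iff)
  ultimately show ?thesis
    by metis
qed

end

section \<open>Polynomials commuting with a transcendental entire function\<close>

theorem theorem3p1:
  fixes p :: nat
    and \<iota> :: "rat \<Rightarrow> 'q::complete_valued_field"
    and w :: "'q alg_closure \<Rightarrow> real"
    and j :: "'q alg_closure \<Rightarrow> 'c::complete_valued_field"
    and P :: "'c poly"
    and F :: "'c fps"
  assumes "prime p"
    and "is_Cp p \<iota> w j"
    and "degree P \<noteq> 0"
    and "transcendental_entire F"
    and "poly P \<circ> entire_fun F = entire_fun F \<circ> poly P"
  shows "P = [:0, 1:] \<or> (\<exists>a b. P = [:b, a:] \<and> (\<exists>n::int. n \<noteq> 0 \<and> a powi n = 1))"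
proof -
  interpret densely_valued "TYPE('c)"
    by unfold_locales (rule ultrametric_Cp[OF assms(1,2)], rule vabs_dense_Cp[OF assms(1,2)])
  have comm: "poly P (entire_fun F x) = entire_fun F (poly P x)" for x
    using fun_cong[OF assms(5), of x] by simp
  have "degree P \<le> 1"
    using degree_le_1_if_commutes[OF assms(4) comm] .
  with assms(3) have "degree P = 1"
    by simp
  then obtain b a where P: "P = [:b, a:]" and "a \<noteq> 0"
    by (cases P) (auto elim!: degree_eq_zeroE split: if_splits)
  have "entire_fun F (a * x + b) = a * entire_fun F x + b" for x
    using comm[of x] by (simp add: P algebra_simps)
  then obtain n :: nat where "n > 0" "a ^ n = 1"
    using root_of_unity_if_commutes_with_affine[OF assms(4) \<open>a \<noteq> 0\<close>] by blast
  then have "int n \<noteq> 0 \<and> a powi int n = 1"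
    by simp
  with P show ?thesis
    by blast
qed

end
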